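(* Let $(\alpha_j)_{j\ge0}$ be real numbers with $-1\le\alpha_j\le 1$ and let $(\ell_j)_{j\ge0}$ be positive integers with $\ell_{j+1}\ge 3\ell_j$ for all $j\ge 0$. Let $\rho$ be the Riesz product generated by the sequences $(\alpha_j)$ and $(\ell_j)$, and let $N_n=\sum_{j=0}^n\ell_j$. Then, for every integer $n\ge 0$, $$\prod_{j=0}^n\frac12\Bigl(1+\sqrt{1-\alpha_j^2}\Bigr)\ \le\ e_{N_n}(\rho)^2\ \le\ \prod_{j=0}^n\Bigl(1-\frac{\alpha_j^2}{4}\Bigr).$$
   Context: $\mathbb{T}$ is the unit circle. The Riesz product $\rho$ generated by $(\alpha_j)$ and $(\ell_j)$ is the weak limit, as $n\to\infty$, of the probability measures $\rho_n$ on $\mathbb{T}$ given by $$d\rho_n(e^{i\theta})=\prod_{j=0}^n\bigl(1+\alpha_j\cos(\ell_j\theta)\bigr)\,\frac{d\theta}{2\pi}.$$ For a finite positive Borel measure $\rho$ on $\mathbb{T}$ and an integer $n\ge 0$, $e_n(\rho)\ge 0$ is defined by $$e_n(\rho)^2=\min_{q_0,\dots,q_{n-1}\in\mathbb{C}}\int_{\mathbb{T}}\bigl|t^n+q_{n-1}t^{n-1}+\dots+q_1t+q_0\bigr|^2\,d\rho(t).$$ *)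

theory Defs
  imports "HOL-Analysis.Analysis"
begin

definition circle_borel :: "complex measure" where
  "circle_borel = restrict_space borel (sphere 0 1)"

definition finite_circle_measure :: "complex measure \<Rightarrow> bool" where
  "finite_circle_measure M \<longleftrightarrow> finite_measure M \<and> sets M = sets circle_borel"

text \<open>Weak convergence of measures on the unit circle. (The library notion
  for real measures is formulated through distribution functions on the line.)\<close>

definition circle_weak_conv :: "(nat \<Rightarrow> complex measure) \<Rightarrow> complex measure \<Rightarrow> bool" where
  "circle_weak_conv M_seq M \<longleftrightarrow>
     (\<forall>f :: complex \<Rightarrow> real. continuous_on (sphere 0 1) f \<longrightarrow>
        (\<lambda>n. \<integral>t. f t \<partial>(M_seq n)) \<longlonglongrightarrow> (\<integral>t. f t \<partial>M))"

text \<open>Push-forward under $\theta \mapsto e^{i\theta}$ of the measure with the given density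
  on $[0, 2\pi)$. The density is nonnegative, so \<^const>\<open>ennreal\<close> truncates nothing,
  whenever all \<open>\<bar>\<alpha> j\<bar> \<le> 1\<close>.\<close>

definition riesz_partial :: "(nat \<Rightarrow> real) \<Rightarrow> (nat \<Rightarrow> nat) \<Rightarrow> nat \<Rightarrow> complex measure" where
  "riesz_partial \<alpha> l n =
     distr (density (restrict_space lborel {0..<2 * pi})
              (\<lambda>\<theta>. ennreal ((\<Prod>j\<le>n. 1 + \<alpha> j * cos (real (l j) * \<theta>)) / (2 * pi))))
           circle_borel cis"

definition riesz_product :: "(nat \<Rightarrow> real) \<Rightarrow> (nat \<Rightarrow> nat) \<Rightarrow> complex measure \<Rightarrow> bool" where
  "riesz_product \<alpha> l \<rho> \<longleftrightarrow>
     finite_circle_measure \<rho> \<and> circle_weak_conv (riesz_partial \<alpha> l) \<rho>"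

text \<open>Only the values \<open>q k\<close> for \<open>k < n\<close> matter.\<close>

definition monic_norm2 :: "complex measure \<Rightarrow> nat \<Rightarrow> (nat \<Rightarrow> complex) \<Rightarrow> real" where
  "monic_norm2 \<rho> n q = (\<integral>t. (cmod (t ^ n + (\<Sum>k<n. q k * t ^ k)))\<^sup>2 \<partial>\<rho>)"

text \<open>The infimum is a minimum, see \<open>extremal_e_attained\<close> below.\<close>

definition extremal_e :: "nat \<Rightarrow> complex measure \<Rightarrow> real" where
  "extremal_e n \<rho> = sqrt (INF q. monic_norm2 \<rho> n q)"

definition bdd_meas :: "complex measure \<Rightarrow> (complex \<Rightarrow> complex) set" where
  "bdd_meas M = {f \<in> borel_measurable M. \<exists>B. \<forall>t\<in>space M. cmod (f t) \<le> B}"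

lemma bdd_meas_diff:
  assumes "f \<in> bdd_meas M" "g \<in> bdd_meas M"
  shows "(\<lambda>t. f t - c * g t) \<in> bdd_meas M"
proof -
  obtain A B where A: "\<forall>t\<in>space M. cmod (f t) \<le> A" and B: "\<forall>t\<in>space M. cmod (g t) \<le> B"
    using assms by (auto simp: bdd_meas_def)
  have "cmod (f t - c * g t) \<le> A + cmod c * B" if "t \<in> space M" for t
  proof -
    have "cmod (f t - c * g t) \<le> cmod (f t) + cmod c * cmod (g t)"
      by (metis norm_mult norm_triangle_ineq4)
    also have "\<dots> \<le> A + cmod c * B"
      using A B that by (intro add_mono mult_left_mono) auto
    finally show ?thesis .
  qed
  thus ?thesis using assms by (auto simp: bdd_meas_def)
qed

lemma bdd_meas_add_scaled:
  assumes "f \<in> bdd_meas M" "g \<in> bdd_meas M"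
  shows "(\<lambda>t. f t + c * g t) \<in> bdd_meas M"
  using bdd_meas_diff[OF assms, of "-c"] by simp

lemma bdd_meas_comb:
  fixes n :: nat
  assumes "g \<in> bdd_meas M" "\<forall>k<n. h k \<in> bdd_meas M"
  shows "(\<lambda>t. g t + (\<Sum>k<n. q k * h k t)) \<in> bdd_meas M"
  using assms(2)
proof (induction n)
  case 0 show ?case using assms(1) by simp
next
  case (Suc n)
  hence "(\<lambda>t. g t + (\<Sum>k<n. q k * h k t)) \<in> bdd_meas M" "h n \<in> bdd_meas M" by simp_all
  from bdd_meas_add_scaled[OF this, of "q n"] show ?case by (simp add: add.assoc)
qed

lemma bdd_meas_integrable:
  assumes "finite_measure M" "f \<in> bdd_meas M" "g \<in> bdd_meas M"
  shows "integrable M (\<lambda>t. f t * cnj (g t))"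
proof -
  obtain A B where A: "\<forall>t\<in>space M. cmod (f t) \<le> A" and B: "\<forall>t\<in>space M. cmod (g t) \<le> B"
    using assms by (auto simp: bdd_meas_def)
  have "cmod (f t * cnj (g t)) \<le> A * B" if "t \<in> space M" for t
    using A B that unfolding norm_mult complex_mod_cnj
    by (intro mult_mono) (auto intro: order_trans[OF norm_ge_zero])
  moreover have "(\<lambda>t. cnj (g t)) \<in> borel_measurable M"
    using assms by (intro borel_measurable_continuous_on[of cnj]) (auto simp: bdd_meas_def intro: continuous_intros)
  hence "(\<lambda>t. f t * cnj (g t)) \<in> borel_measurable M"
    using assms by (auto simp: bdd_meas_def)
  ultimately show ?thesis
    by (intro finite_measure.integrable_const_bound[OF assms(1), of _ "A * B"]) auto
qed

lemma bdd_meas_integrable_norm2: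
  assumes "finite_measure M" "f \<in> bdd_meas M"
  shows "integrable M (\<lambda>t. (cmod (f t))\<^sup>2)"
proof -
  have "integrable M (\<lambda>t. cmod (f t * cnj (f t)))"
    using bdd_meas_integrable[OF assms assms(2)] by (rule integrable_norm)
  thus ?thesis by (simp add: norm_mult power2_eq_square)
qed

lemma norm2_orthogonal_le:
  assumes M: "finite_measure M" and u: "u \<in> bdd_meas M" and h: "h \<in> bdd_meas M"
    and orth: "(\<integral>t. u t * cnj (h t) \<partial>M) = 0"
  shows "(\<integral>t. (cmod (u t))\<^sup>2 \<partial>M) \<le> (\<integral>t. (cmod (u t + c * h t))\<^sup>2 \<partial>M)"
proof -
  have *: "(cmod (u t + c * h t))\<^sup>2
      = (cmod (u t))\<^sup>2 + 2 * Re (cnj c * (u t * cnj (h t))) + (cmod c)\<^sup>2 * (cmod (h t))\<^sup>2" for t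
    unfolding cmod_power2 by (simp add: power2_eq_square algebra_simps)
  have i1: "integrable M (\<lambda>t. cnj c * (u t * cnj (h t)))"
    using bdd_meas_integrable[OF M u h] by simp
  have "(\<integral>t. Re (cnj c * (u t * cnj (h t))) \<partial>M) = Re (\<integral>t. cnj c * (u t * cnj (h t)) \<partial>M)"
    using i1 by (rule integral_Re)
  also have "\<dots> = 0"
    using orth by simp
  finally have 0: "(\<integral>t. Re (cnj c * (u t * cnj (h t))) \<partial>M) = 0" .
  have i2: "integrable M (\<lambda>t. Re (cnj c * (u t * cnj (h t))))"
    using i1 by (rule integrable_Re)
  have "(\<integral>t. (cmod (u t + c * h t))\<^sup>2 \<partial>M)
      = (\<integral>t. (cmod (u t))\<^sup>2 \<partial>M) + 2 * (\<integral>t. Re (cnj c * (u t * cnj (h t))) \<partial>M)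
        + (cmod c)\<^sup>2 * (\<integral>t. (cmod (h t))\<^sup>2 \<partial>M)"
    unfolding *
    using i2 bdd_meas_integrable_norm2[OF M u] bdd_meas_integrable_norm2[OF M h]
    by (simp del: times_complex.sel)
  thus ?thesis unfolding 0 by simp
qed

lemma least_squares_attained:
  fixes n :: nat
  assumes M: "finite_measure M" and "g \<in> bdd_meas M" "\<forall>k<n. h k \<in> bdd_meas M"
  shows "\<exists>q. \<forall>q'. (\<integral>t. (cmod (g t + (\<Sum>k<n. q k * h k t)))\<^sup>2 \<partial>M)
                 \<le> (\<integral>t. (cmod (g t + (\<Sum>k<n. q' k * h k t)))\<^sup>2 \<partial>M)"
  using assms(2,3)
proof (induction n arbitrary: g h)
  case 0 show ?case by simp
next
  case (Suc n)
  define w where "w = h n"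
  define c where "c f = (\<integral>t. f t * cnj (w t) \<partial>M) / (\<integral>t. w t * cnj (w t) \<partial>M)" for f
  define P where "P f = (\<lambda>t. f t - c f * w t)" for f
  have w: "w \<in> bdd_meas M" using Suc.prems by (simp add: w_def)
  have P: "P f \<in> bdd_meas M" if "f \<in> bdd_meas M" for f
    unfolding P_def using that w by (rule bdd_meas_diff)
  have orth: "(\<integral>t. P f t * cnj (w t) \<partial>M) = 0" if f: "f \<in> bdd_meas M" for f
  proof (cases "(\<integral>t. w t * cnj (w t) \<partial>M) = 0")
    case True
    have "(\<integral>t. w t * cnj (w t) \<partial>M) = of_real (\<integral>t. (cmod (w t))\<^sup>2 \<partial>M)"
      by (simp add: complex_norm_square[symmetric] flip: of_real_power)
    with True have "(\<integral>t. (cmod (w t))\<^sup>2 \<partial>M) = 0" by simp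
    hence "AE t in M. (cmod (w t))\<^sup>2 = 0"
      by (subst (asm) integral_nonneg_eq_0_iff_AE[OF bdd_meas_integrable_norm2[OF M w]]) auto
    hence "AE t in M. P f t * cnj (w t) = 0" by eventually_elim simp
    thus ?thesis by (rule integral_eq_zero_AE)
  next
    case False
    have "(\<integral>t. P f t * cnj (w t) \<partial>M)
        = (\<integral>t. f t * cnj (w t) - c f * (w t * cnj (w t)) \<partial>M)"
      by (simp add: P_def algebra_simps)
    also have "\<dots> = (\<integral>t. f t * cnj (w t) \<partial>M) - c f * (\<integral>t. w t * cnj (w t) \<partial>M)"
      using bdd_meas_integrable[OF M f w] bdd_meas_integrable[OF M w w] by simp
    also have "\<dots> = 0" using False by (simp add: c_def)
    finally show ?thesis .
  qed
  have hk: "h k \<in> bdd_meas M" if "k < n" for k using that Suc.prems(2) by simp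
  obtain q where q: "\<And>q'. (\<integral>t. (cmod (P g t + (\<Sum>k<n. q k * P (h k) t)))\<^sup>2 \<partial>M)
                 \<le> (\<integral>t. (cmod (P g t + (\<Sum>k<n. q' k * P (h k) t)))\<^sup>2 \<partial>M)"
    using Suc.IH[of "P g" "\<lambda>k. P (h k)"] P Suc.prems(1) hk by blast
  define C where "C q = c g + (\<Sum>k<n. q k * c (h k))" for q
  have split: "P g t + (\<Sum>k<n. q k * P (h k) t)
      = g t + (\<Sum>k<n. q k * h k t) - C q * w t" for q t
    by (simp add: P_def C_def algebra_simps sum_subtractf sum_distrib_left)
  have orthq: "(\<integral>t. (P g t + (\<Sum>k<n. q k * P (h k) t)) * cnj (w t) \<partial>M) = 0" for q
  proof -
    have "(\<integral>t. (P g t + (\<Sum>k<n. q k * P (h k) t)) * cnj (w t) \<partial>M)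
        = (\<integral>t. P g t * cnj (w t) + (\<Sum>k<n. q k * (P (h k) t * cnj (w t))) \<partial>M)"
      by (simp add: algebra_simps sum_distrib_left)
    also have "\<dots> = (\<integral>t. P g t * cnj (w t) \<partial>M)
        + (\<Sum>k<n. q k * (\<integral>t. P (h k) t * cnj (w t) \<partial>M))"
      using bdd_meas_integrable[OF M P[OF Suc.prems(1)] w] bdd_meas_integrable[OF M P[OF hk] w]
      by (subst Bochner_Integration.integral_add) (auto simp: Bochner_Integration.integral_sum)
    also have "\<dots> = 0" using orth Suc.prems(1) hk by simp
    finally show ?thesis .
  qed
  define r where "r = q(n := - C q)"
  have "(\<integral>t. (cmod (g t + (\<Sum>k<Suc n. r k * h k t)))\<^sup>2 \<partial>M)
      \<le> (\<integral>t. (cmod (g t + (\<Sum>k<Suc n. q' k * h k t)))\<^sup>2 \<partial>M)" for q'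
  proof -
    have "(\<integral>t. (cmod (g t + (\<Sum>k<Suc n. r k * h k t)))\<^sup>2 \<partial>M)
        = (\<integral>t. (cmod (P g t + (\<Sum>k<n. q k * P (h k) t)))\<^sup>2 \<partial>M)"
      unfolding split by (simp add: r_def w_def algebra_simps)
    also have "\<dots> \<le> (\<integral>t. (cmod (P g t + (\<Sum>k<n. q' k * P (h k) t)))\<^sup>2 \<partial>M)"
      by (rule q)
    also have "\<dots> \<le> (\<integral>t. (cmod (P g t + (\<Sum>k<n. q' k * P (h k) t) + (q' n + C q') * w t))\<^sup>2 \<partial>M)"
      using P Suc.prems(1) hk by (intro norm2_orthogonal_le M w orthq bdd_meas_comb) auto
    also have "\<dots> = (\<integral>t. (cmod (g t + (\<Sum>k<Suc n. q' k * h k t)))\<^sup>2 \<partial>M)"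
      unfolding split by (simp add: w_def algebra_simps)
    finally show ?thesis .
  qed
  thus ?case by blast
qed

lemma extremal_e_attained:
  assumes "finite_circle_measure \<rho>"
  shows "\<exists>q. (extremal_e n \<rho>)\<^sup>2 = monic_norm2 \<rho> n q \<and> (\<forall>q'. monic_norm2 \<rho> n q \<le> monic_norm2 \<rho> n q')"
proof -
  have fin: "finite_measure \<rho>" and sets: "sets \<rho> = sets circle_borel"
    using assms by (auto simp: finite_circle_measure_def)
  have space: "space \<rho> = sphere 0 1"
    using sets_eq_imp_space_eq[OF sets] by (simp add: circle_borel_def space_restrict_space)
  have pow: "(\<lambda>t. t ^ k) \<in> bdd_meas \<rho>" for k
  proof -
    have "(\<lambda>t::complex. t ^ k) \<in> borel_measurable circle_borel"
      unfolding circle_borel_def by (intro measurable_restrict_space1) measurable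
    hence "(\<lambda>t::complex. t ^ k) \<in> borel_measurable \<rho>"
      using measurable_cong_sets[OF sets refl] by blast
    moreover have "\<forall>t\<in>space \<rho>. cmod (t ^ k) \<le> 1" by (simp add: space norm_power)
    ultimately show ?thesis unfolding bdd_meas_def by blast
  qed
  obtain q where q: "\<And>q'. monic_norm2 \<rho> n q \<le> monic_norm2 \<rho> n q'"
    using least_squares_attained[OF fin pow[of n], of n "\<lambda>k t. t ^ k"] pow
    unfolding monic_norm2_def by blast
  have "(INF q. monic_norm2 \<rho> n q) = monic_norm2 \<rho> n q"
    using q by (intro cInf_eq_minimum) auto
  moreover have "0 \<le> monic_norm2 \<rho> n q"
    unfolding monic_norm2_def by simp
  ultimately show ?thesis using q unfolding extremal_e_def by auto
qed

end

theory Submission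
  imports Defs
begin

text \<open>Write \<open>w\<^sub>n\<close> for the partial product and \<open>N\<^sub>n = l 0 + \<dots> + l n\<close>. Lacunarity gives
  \<open>2 N\<^sub>m < l (m + 1)\<close>, so if \<open>P\<close> has degree at most \<open>N\<^sub>n\<close> and \<open>m \<ge> n\<close>, then \<open>\<bar>P\<bar>\<^sup>2 w\<^sub>m\<close> is orthogonal to
  \<open>cos (l (m + 1) \<theta>)\<close>. Hence \<open>\<bar>P\<bar>\<^sup>2\<close> has the same integral against \<open>\<rho>\<close> as against \<open>w\<^sub>n\<close>.

  Lower bound: with \<open>s = sqrt (1 - \<alpha>\<^sup>2)\<close> and \<open>b = \<alpha> / (1 + s)\<close>, each factor of \<open>w\<^sub>n\<close> is
  \<open>(1 + s) / 2\<close> times the squared modulus of \<open>t ^ l + b\<close>. So \<open>\<bar>P\<bar>\<^sup>2 w\<^sub>n\<close> is the product of the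
  \<open>(1 + s) / 2\<close> times the squared modulus of a monic polynomial, whose mean is at least 1 by Parseval.

  Upper bound: test with \<open>P = \<Prod> (t ^ l j - \<alpha> j / 2)\<close>. Each factor of \<open>\<bar>P\<bar>\<^sup>2 w\<^sub>n\<close> has mean
  \<open>1 - (\<alpha> j)\<^sup>2 / 4\<close> and nonzero frequencies \<open>\<plusminus> l j\<close>, \<open>\<plusminus> 2 l j\<close> only; these cannot cancel across
  factors, so the mean of the product is the product of the means.\<close>

section \<open>Trigonometric polynomials with prescribed frequencies\<close>

text \<open>\<open>S\<close> only has to contain the frequencies that occur, so degree bounds, gaps
  and the absence of a mean all become conditions on a set of integers, with no bookkeeping of
  coefficients.\<close>

inductive_set trig :: "int set \<Rightarrow> (real \<Rightarrow> complex) set" for S where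
  zero: "(\<lambda>x. 0) \<in> trig S"
| add: "f \<in> trig S \<Longrightarrow> k \<in> S \<Longrightarrow> (\<lambda>x. c * cis (real_of_int k * x) + f x) \<in> trig S"

lemma trig_cis: "k \<in> S \<Longrightarrow> (\<lambda>x. c * cis (real_of_int k * x)) \<in> trig S"
  using trig.add[OF trig.zero, of k S c] by simp

lemma trig_const: "0 \<in> S \<Longrightarrow> (\<lambda>x. c) \<in> trig S"
  using trig_cis[of 0 S c] by simp

lemma trig_mono: "f \<in> trig S \<Longrightarrow> S \<subseteq> T \<Longrightarrow> f \<in> trig T"
  by (induction rule: trig.induct) (auto intro: trig.intros)

lemma trig_sum2: "f \<in> trig S \<Longrightarrow> g \<in> trig S \<Longrightarrow> (\<lambda>x. f x + g x) \<in> trig S"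
proof (induction rule: trig.induct)
  case (add f k c)
  then show ?case using trig.add[of "\<lambda>x. f x + g x" S k c] by (simp add: add.assoc)
qed simp

lemma trig_sum: "(\<And>i. i \<in> I \<Longrightarrow> f i \<in> trig S) \<Longrightarrow> (\<lambda>x. \<Sum>i\<in>I. f i x) \<in> trig S"
  by (induction I rule: infinite_finite_induct) (auto intro: trig.zero trig_sum2)

lemma trig_cis_mult:
  assumes "f \<in> trig S" "\<And>k. k \<in> S \<Longrightarrow> j + k \<in> T"
  shows "(\<lambda>x. c * cis (real_of_int j * x) * f x) \<in> trig T"
  using assms
proof (induction rule: trig.induct)
  case zero
  show ?case by (simp add: trig.zero)
next
  case (add f k d)
  have "(\<lambda>x. c * cis (real_of_int j * x) * (d * cis (real_of_int k * x) + f x))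
      = (\<lambda>x. (c * d) * cis (real_of_int (j + k) * x) + c * cis (real_of_int j * x) * f x)"
    by (simp add: fun_eq_iff algebra_simps flip: cis_mult)
  also have "\<dots> \<in> trig T" using add by (intro trig.add) auto
  finally show ?case .
qed

lemma trig_mult:
  assumes "f \<in> trig S" "g \<in> trig T" "\<And>j k. j \<in> S \<Longrightarrow> k \<in> T \<Longrightarrow> j + k \<in> U"
  shows "(\<lambda>x. f x * g x) \<in> trig U"
  using assms
proof (induction rule: trig.induct)
  case zero
  show ?case by (simp add: trig.zero)
next
  case (add f k c)
  have "(\<lambda>x. c * cis (real_of_int k * x) * g x + f x * g x) \<in> trig U"
    using add by (intro trig_sum2 trig_cis_mult[of g T]) auto
  then show ?case by (simp add: algebra_simps)
qed

lemma trig_cnj: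
  assumes "f \<in> trig S" "\<And>k. k \<in> S \<Longrightarrow> - k \<in> T"
  shows "(\<lambda>x. cnj (f x)) \<in> trig T"
  using assms
proof (induction rule: trig.induct)
  case zero
  show ?case by (simp add: trig.zero)
next
  case (add f k c)
  then show ?case using trig.add[of "\<lambda>x. cnj (f x)" T "- k" "cnj c"] by (simp add: cis_cnj)
qed

lemma trig_continuous_on: "f \<in> trig S \<Longrightarrow> continuous_on A f"
  by (induction rule: trig.induct) (auto intro!: continuous_intros)

section \<open>Integrals over a full period\<close>

lemma cis_has_integral_0:
  assumes "k \<noteq> 0"
  shows "((\<lambda>x. cis (real_of_int k * x)) has_integral 0) {0..2 * pi}"
proof -
  define F where "F z = exp (\<i> * of_int k * z) / (\<i> * of_int k)" for z :: complex
  have "(F has_field_derivative exp (\<i> * of_int k * z)) (at z)" for z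
    unfolding F_def using assms by (auto intro!: derivative_eq_intros)
  then have "((\<lambda>x. F (of_real x)) has_vector_derivative cis (real_of_int k * x)) (at x within A)" for x A
    using has_vector_derivative_real_field[of F "cis (real_of_int k * x)" x A]
    by (simp add: cis_conv_exp mult.assoc)
  then have "((\<lambda>x. cis (real_of_int k * x)) has_integral F (of_real (2 * pi)) - F (of_real 0)) {0..2 * pi}"
    by (intro fundamental_theorem_of_calculus) auto
  moreover have "exp (\<i> * of_int k * of_real (2 * pi)) = cis (2 * pi * real_of_int k)"
    by (simp add: cis_conv_exp mult_ac)
  then have "F (of_real (2 * pi)) = F (of_real 0)"
    by (simp add: F_def cis_multiple_2pi del: of_real_mult)
  ultimately show ?thesis by simp
qed

text \<open>Integration over a period sees only frequency 0. All orthogonality arguments below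
  reduce to this.\<close>

lemma trig_has_integral_0:
  assumes "f \<in> trig S" "0 \<notin> S"
  shows "(f has_integral 0) {0..2 * pi}"
  using assms
proof (induction rule: trig.induct)
  case (add f k c)
  then have "k \<noteq> 0" by auto
  from has_integral_add[OF has_integral_mult_right[OF cis_has_integral_0[OF this], of c]] add
  show ?case by fastforce
qed simp

section \<open>Monic polynomials on the unit circle\<close>

text \<open>These are the monic polynomials of degree \<open>n\<close> in e^{ix}. Describing the
  lower terms by their frequencies makes closure under products a matter of adding
  frequencies.\<close>

definition monic_trig :: "nat \<Rightarrow> (real \<Rightarrow> complex) \<Rightarrow> bool" where
  "monic_trig n f \<longleftrightarrow> (\<exists>p\<in>trig {0..<int n}. f = (\<lambda>x. cis (real n * x) + p x))"

lemma monic_trig_mult: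
  assumes "monic_trig m f" "monic_trig n g"
  shows "monic_trig (m + n) (\<lambda>x. f x * g x)"
proof -
  obtain p q where p: "p \<in> trig {0..<int m}" and f: "f = (\<lambda>x. cis (real m * x) + p x)"
    and q: "q \<in> trig {0..<int n}" and g: "g = (\<lambda>x. cis (real n * x) + q x)"
    using assms by (auto simp: monic_trig_def)
  have "(\<lambda>x. 1 * cis (real_of_int (int m) * x) * q x) \<in> trig {0..<int (m + n)}"
    using q by (rule trig_cis_mult) auto
  moreover have "(\<lambda>x. 1 * cis (real_of_int (int n) * x) * p x) \<in> trig {0..<int (m + n)}"
    using p by (rule trig_cis_mult) auto
  moreover have "(\<lambda>x. p x * q x) \<in> trig {0..<int (m + n)}"
    using p q by (rule trig_mult) auto
  ultimately have "(\<lambda>x. 1 * cis (real_of_int (int m) * x) * q x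
      + 1 * cis (real_of_int (int n) * x) * p x + p x * q x) \<in> trig {0..<int (m + n)}"
    by (intro trig_sum2)
  then show ?thesis
    unfolding monic_trig_def f g
    by (rule bexI[rotated]) (simp add: fun_eq_iff algebra_simps flip: cis_mult)
qed

lemma monic_trig_prod:
  fixes n :: nat
  assumes "\<And>j. monic_trig (l j) (f j)"
  shows "monic_trig (\<Sum>j\<le>n. l j) (\<lambda>x. \<Prod>j\<le>n. f j x)"
  by (induction n) (use assms in \<open>auto intro: monic_trig_mult\<close>)

text \<open>Positivity of \<open>n\<close> puts the frequency 0 of the constant strictly below the
  leading one.\<close>

lemma monic_trig_cis_const: "0 < n \<Longrightarrow> monic_trig n (\<lambda>x. cis (real n * x) + c)"
  unfolding monic_trig_def by (auto intro!: bexI[OF _ trig_const[of _ c]])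

lemma monic_trig_polynomial: "monic_trig n (\<lambda>x. cis x ^ n + (\<Sum>k<n. q k * cis x ^ k))"
proof -
  have "(\<lambda>x. \<Sum>k<n. q k * cis (real_of_int (int k) * x)) \<in> trig {0..<int n}"
    by (intro trig_sum trig_cis) auto
  then show ?thesis
    unfolding monic_trig_def by (rule bexI[rotated]) (simp add: Complex.DeMoivre)
qed

text \<open>Recovers the explicit coefficients that \<open>monic_norm2\<close> takes as its
  argument.\<close>

lemma trig_polynomialE:
  assumes "f \<in> trig {0..<int n}"
  obtains q where "f = (\<lambda>x. \<Sum>k<n. q k * cis x ^ k)"
proof -
  from assms have "\<exists>q. f = (\<lambda>x. \<Sum>k<n. q k * cis x ^ k)"
  proof (induction rule: trig.induct)
    case zero
    show ?case by (rule exI[of _ "\<lambda>_. 0"]) simp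
  next
    case (add f k c)
    then obtain q where q: "f = (\<lambda>x. \<Sum>k<n. q k * cis x ^ k)" by auto
    have k: "nat k < n" "real (nat k) = of_int k" using add by auto
    have "(\<Sum>j<n. (if j = nat k then c else 0) * cis x ^ j) = c * cis (real_of_int k * x)" for x
      using k by (simp add: Complex.DeMoivre if_distrib[of "\<lambda>a. a * _"] cong: if_cong)
    then show ?case unfolding q
      by (intro exI[of _ "\<lambda>j. (if j = nat k then c else 0) + q j"])
         (simp add: fun_eq_iff distrib_right sum.distrib)
  qed
  then show ?thesis using that by blast
qed

lemma monic_trig_in_trig: "monic_trig n f \<Longrightarrow> f \<in> trig {0..int n}"
  unfolding monic_trig_def
  using trig_cis[of "int n" "{0..int n}" 1]
  by (auto intro!: trig_sum2 intro: trig_mono)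

lemma cmod_sq_trig:
  assumes "f \<in> trig {0..int n}"
  shows "(\<lambda>x. complex_of_real ((cmod (f x))\<^sup>2)) \<in> trig {- int n..int n}"
  unfolding complex_norm_square
  using assms by (rule trig_mult[OF _ trig_cnj[OF assms, of "{- int n..0}"]]) auto

text \<open>The part of Parseval that is needed: the leading term contributes 1 to the mean, the
  lower part a nonnegative amount, and the cross term nothing.\<close>

lemma monic_trig_norm2_ge_1:
  assumes "monic_trig n f"
  shows "2 * pi \<le> integral {0..2 * pi} (\<lambda>x. (cmod (f x))\<^sup>2)"
proof -
  obtain p where p: "p \<in> trig {0..<int n}" and f: "f = (\<lambda>x. cis (real n * x) + p x)"
    using assms by (auto simp: monic_trig_def)
  \<comment> \<open>Multiplication by e^{-inx} shifts the frequencies 0, ..., n-1 of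
    \<open>p\<close> below 0, so the cross term has mean zero.\<close>
  have "(\<lambda>x. 1 * cis (real_of_int (- int n) * x) * p x) \<in> trig {..<0}"
    using p by (rule trig_cis_mult) auto
  then have "((\<lambda>x. cis (- (real n * x)) * p x) has_integral 0) {0..2 * pi}"
    by (intro trig_has_integral_0[of _ "{..<0}"]) auto
  from has_integral_Re[OF this]
  have cross: "((\<lambda>x. Re (cis (- (real n * x)) * p x)) has_integral 0) {0..2 * pi}"
    by simp
  have "(\<lambda>x. (cmod (p x))\<^sup>2) integrable_on {0..2 * pi}"
    by (intro integrable_continuous_real continuous_intros trig_continuous_on[OF p])
  then obtain I where I: "((\<lambda>x. (cmod (p x))\<^sup>2) has_integral I) {0..2 * pi}" by blast
  have "0 \<le> I" using I by (rule has_integral_nonneg) simp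
  have "(cmod (f x))\<^sup>2 = 1 + 2 * Re (cis (- (real n * x)) * p x) + (cmod (p x))\<^sup>2" for x
    using sin_cos_squared_add[of "real n * x"]
    unfolding f cmod_power2 by (simp add: power2_eq_square algebra_simps)
  moreover have "((\<lambda>x. 1 + 2 * Re (cis (- (real n * x)) * p x) + (cmod (p x))\<^sup>2)
      has_integral 2 * pi + 2 * 0 + I) {0..2 * pi}"
    using has_integral_const_real[of "1::real" 0 "2 * pi"]
    by (intro has_integral_add has_integral_mult_right cross I) simp
  ultimately have "((\<lambda>x. (cmod (f x))\<^sup>2) has_integral 2 * pi + 2 * 0 + I) {0..2 * pi}" by simp
  then show ?thesis using \<open>0 \<le> I\<close> by (simp add: integral_unique)
qed

section \<open>Means of products with separated frequencies\<close>

lemma trig_prod: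
  fixes n :: nat
  assumes "\<And>j. g j \<in> trig {- int (d j)..int (d j)}"
  shows "(\<lambda>x. \<Prod>j\<le>n. g j x) \<in> trig {- int (\<Sum>j\<le>n. d j)..int (\<Sum>j\<le>n. d j)}"
proof (induction n)
  case (Suc n)
  have "(\<lambda>x. (\<Prod>j\<le>n. g j x) * g (Suc n) x)
      \<in> trig {- int (\<Sum>j\<le>Suc n. d j)..int (\<Sum>j\<le>Suc n. d j)}"
    using Suc assms by (rule trig_mult) auto
  then show ?case by simp
qed (use assms in simp)

lemma high_frequency_has_integral_0:
  assumes "f \<in> trig {- a..a}" "g \<in> trig {k. a < \<bar>k\<bar>}"
  shows "((\<lambda>x. f x * g x) has_integral 0) {0..2 * pi}"
proof (rule trig_has_integral_0)
  show "(\<lambda>x. f x * g x) \<in> trig (- {0})"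
    using assms by (rule trig_mult) auto
qed simp

lemma cos_trig: "k \<in> S \<Longrightarrow> - k \<in> S \<Longrightarrow> (\<lambda>x. complex_of_real (a * cos (real_of_int k * x))) \<in> trig S"
proof -
  assume "k \<in> S" "- k \<in> S"
  then have "(\<lambda>x. of_real (a / 2) * cis (real_of_int k * x)
      + of_real (a / 2) * cis (real_of_int (- k) * x)) \<in> trig S"
    by (intro trig_sum2 trig_cis)
  moreover have "of_real (a / 2) * cis (real_of_int k * x)
      + of_real (a / 2) * cis (real_of_int (- k) * x) = of_real (a * cos (real_of_int k * x))" for x
    by (simp add: complex_eq_iff)
  ultimately show ?thesis by simp
qed

text \<open>The first factors together have frequencies of modulus at most the sum of their
  \<open>d j\<close>, and \<open>h (Suc m)\<close> lies beyond that. So the oscillating part of each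
  new factor integrates to zero against the product so far, and only its mean
  \<open>c (Suc m)\<close> survives.\<close>

lemma lacunary_product_has_integral:
  fixes c :: "nat \<Rightarrow> complex" and d :: "nat \<Rightarrow> nat"
  assumes h: "\<And>j. h j \<in> trig {k. 0 < \<bar>k\<bar> \<and> \<bar>k\<bar> \<le> int (d j)}"
    and gap: "\<And>m. h (Suc m) \<in> trig {k. int (\<Sum>j\<le>m. d j) < \<bar>k\<bar>}"
  shows "((\<lambda>x. \<Prod>j\<le>n. c j + h j x) has_integral of_real (2 * pi) * (\<Prod>j\<le>n. c j)) {0..2 * pi}"
proof (induction n)
  case 0
  have "(h 0 has_integral 0) {0..2 * pi}"
    using h[of 0] by (rule trig_has_integral_0) simp
  from has_integral_add[OF has_integral_const_real[of "c 0" 0 "2 * pi"] this]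
  show ?case by (simp add: scaleR_conv_of_real)
next
  case (Suc n)
  have "(\<lambda>x. c j + h j x) \<in> trig {- int (d j)..int (d j)}" for j
    by (intro trig_sum2 trig_const trig_mono[OF h]) auto
  from has_integral_add[OF has_integral_mult_left[OF Suc, of "c (Suc n)"]
      high_frequency_has_integral_0[OF trig_prod[OF this] gap]]
  show ?case by (simp add: algebra_simps)
qed

section \<open>Partial Riesz products as integrals over a period\<close>

lemma cis_measurable: "cis \<in> borel \<rightarrow>\<^sub>M circle_borel"
  unfolding circle_borel_def
  by (intro measurable_restrict_space2 borel_measurable_continuous_onI continuous_intros) auto

text \<open>Moves from the pushed-forward measure to the Henstock-Kurzweil integral in which the
  Fourier arguments are stated. The bound on \<alpha> makes the density nonnegative, so
  \<open>ennreal\<close> truncates nothing.\<close>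

lemma integral_riesz_partial:
  fixes f :: "complex \<Rightarrow> real"
  assumes a: "\<And>j. - 1 \<le> \<alpha> j \<and> \<alpha> j \<le> 1" and f: "continuous_on (sphere 0 1) f"
  shows "(\<integral>t. f t \<partial>(riesz_partial \<alpha> l n))
    = integral {0..2 * pi} (\<lambda>x. f (cis x) * (\<Prod>j\<le>n. 1 + \<alpha> j * cos (real (l j) * x))) / (2 * pi)"
proof -
  define w where "w x = (\<Prod>j\<le>n. 1 + \<alpha> j * cos (real (l j) * x)) / (2 * pi)" for x
  have w_cont: "continuous_on A w" for A
    unfolding w_def by (intro continuous_intros) auto
  have w_meas: "w \<in> borel_measurable borel"
    by (intro borel_measurable_continuous_onI w_cont)
  have "0 \<le> 1 + \<alpha> j * cos y" for j y
  proof -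
    have "\<bar>\<alpha> j * cos y\<bar> \<le> 1 * 1"
      unfolding abs_mult using a[of j] by (intro mult_mono) auto
    then show ?thesis by linarith
  qed
  then have w_nonneg: "0 \<le> w x" for x
    unfolding w_def by (intro divide_nonneg_nonneg prod_nonneg) auto
  have f_meas: "f \<in> borel_measurable circle_borel"
    unfolding circle_borel_def using f by (rule borel_measurable_continuous_on_restrict)
  have fcis_meas: "(\<lambda>x. f (cis x)) \<in> borel_measurable borel"
    using measurable_compose[OF cis_measurable f_meas] .
  have fcis_cont: "continuous_on A (\<lambda>x. f (cis x))" for A
    by (rule continuous_on_compose2[OF f]) (auto intro: continuous_intros)
  define M where "M = restrict_space lborel {0..<2 * pi}"
  have M: "g \<in> borel_measurable borel \<Longrightarrow> g \<in> borel_measurable M" for g :: "real \<Rightarrow> real"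
    unfolding M_def by (intro measurable_restrict_space1) simp
  have cis_M: "cis \<in> density M (\<lambda>x. ennreal (w x)) \<rightarrow>\<^sub>M circle_borel"
    using cis_measurable unfolding M_def by (auto intro: measurable_restrict_space1)
  have "(\<integral>t. f t \<partial>(riesz_partial \<alpha> l n)) = (\<integral>x. f (cis x) \<partial>(density M (\<lambda>x. ennreal (w x))))"
    unfolding riesz_partial_def w_def[symmetric] M_def[symmetric]
    using cis_M f_meas by (rule integral_distr)
  also have "\<dots> = (\<integral>x. w x * f (cis x) \<partial>M)"
    using w_nonneg by (intro integral_real_density M fcis_meas w_meas) auto
  also have "\<dots> = (LINT x:{0..<2 * pi}|lborel. w x * f (cis x))"
    unfolding M_def set_lebesgue_integral_def by (subst integral_restrict_space) auto
  also have "\<dots> = integral {0..<2 * pi} (\<lambda>x. w x * f (cis x))"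
  proof (rule set_borel_integral_eq_integral)
    have "set_integrable lborel {0..2 * pi} (\<lambda>x. w x * f (cis x))"
      by (intro borel_integrable_atLeastAtMost' continuous_intros w_cont fcis_cont)
    then show "set_integrable lborel {0..<2 * pi} (\<lambda>x. w x * f (cis x))"
      by (rule set_integrable_subset) auto
  qed
  also have "\<dots> = integral {0..2 * pi} (\<lambda>x. w x * f (cis x))"
    by (rule integral_spike_set; rule negligible_subset[of "{2 * pi}"]) auto
  also have "\<dots> = integral {0..2 * pi}
      (\<lambda>x. (f (cis x) * (\<Prod>j\<le>n. 1 + \<alpha> j * cos (real (l j) * x))) / (2 * pi))"
    by (simp add: w_def mult.commute)
  finally show ?thesis by simp
qed

section \<open>Lacunary weights and stability of integrals\<close>

context
  fixes \<alpha> :: "nat \<Rightarrow> real" and l :: "nat \<Rightarrow> nat"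
  assumes bound: "\<And>j. - 1 \<le> \<alpha> j \<and> \<alpha> j \<le> 1"
    and pos: "\<And>j. 0 < l j"
    and lacunary: "\<And>j. l (Suc j) \<ge> 3 * l j"
begin

lemma lacunary_gap: "2 * (\<Sum>j\<le>n. l j) < l (Suc n)"
proof -
  \<comment> \<open>Stated with \<open>3 * l n\<close> so that induction goes through: the step adds
    \<open>2 * l (Suc n)\<close> to \<open>3 * l n\<close>, which is at most
    \<open>l (Suc n)\<close>.\<close>
  have "2 * (\<Sum>j\<le>n. l j) < 3 * l n"
  proof (induction n)
    case 0
    show ?case using pos[of 0] by simp
  next
    case (Suc n)
    then show ?case using lacunary[of n] by simp
  qed
  then show ?thesis using lacunary[of n] by linarith
qed

text \<open>The density of \<open>riesz_partial\<close> without its factor 1/(2 pi), which stays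
  outside the integrals.\<close>

definition weight :: "nat \<Rightarrow> real \<Rightarrow> real" where
  "weight n x = (\<Prod>j\<le>n. 1 + \<alpha> j * cos (real (l j) * x))"

lemma weight_trig:
  "(\<lambda>x. complex_of_real (weight n x)) \<in> trig {- int (\<Sum>j\<le>n. l j)..int (\<Sum>j\<le>n. l j)}"
proof -
  have "(\<lambda>x. 1 + complex_of_real (\<alpha> j * cos (real_of_int (int (l j)) * x)))
      \<in> trig {- int (l j)..int (l j)}" for j
    by (intro trig_sum2 trig_const cos_trig) auto
  from trig_prod[OF this] show ?thesis by (simp add: weight_def)
qed

text \<open>The product of \<open>f\<close> and the current weight has degree at most twice the sum
  of the \<open>l j\<close> used so far. By \<open>lacunary_gap\<close> the next cosine has a larger
  frequency, so its contribution vanishes.\<close>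

lemma integral_weight_stable:
  assumes "(\<lambda>x. complex_of_real (f x)) \<in> trig {- int (\<Sum>j\<le>n. l j)..int (\<Sum>j\<le>n. l j)}"
  shows "integral {0..2 * pi} (\<lambda>x. f x * weight (n + m) x)
       = integral {0..2 * pi} (\<lambda>x. f x * weight n x)"
proof (induction m)
  case (Suc m)
  let ?N = "int (\<Sum>j\<le>n + m. l j)"
  let ?e = "\<lambda>x. \<alpha> (Suc (n + m)) * cos (real_of_int (int (l (Suc (n + m)))) * x)"
  have "(\<Sum>j\<le>n. l j) \<le> (\<Sum>j\<le>n + m. l j)" by (intro sum_mono2) auto
  then have "(\<lambda>x. complex_of_real (f x)) \<in> trig {- ?N..?N}"
    by (intro trig_mono[OF assms]) (auto simp del: of_nat_sum)
  from trig_mult[OF this weight_trig[of "n + m"]]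
  have fw: "(\<lambda>x. complex_of_real (f x) * complex_of_real (weight (n + m) x)) \<in> trig {- (2 * ?N)..2 * ?N}"
    by simp
  have "2 * ?N < int (l (Suc (n + m)))" using lacunary_gap[of "n + m"] by linarith
  then have "(\<lambda>x. complex_of_real (?e x)) \<in> trig {k. 2 * ?N < \<bar>k\<bar>}"
    by (intro cos_trig) auto
  from has_integral_Re[OF high_frequency_has_integral_0[OF fw this]]
  have 0: "((\<lambda>x. f x * weight (n + m) x * ?e x) has_integral 0) {0..2 * pi}"
    by simp
  have "continuous_on {0..2 * pi} (\<lambda>x. Re (complex_of_real (f x) * complex_of_real (weight (n + m) x)))"
    by (intro continuous_intros trig_continuous_on[OF fw])
  then have "(\<lambda>x. f x * weight (n + m) x) integrable_on {0..2 * pi}"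
    by (intro integrable_continuous_real) simp
  from has_integral_add[OF integrable_integral[OF this] 0]
  have "((\<lambda>x. f x * weight (n + Suc m) x) has_integral
      integral {0..2 * pi} (\<lambda>x. f x * weight (n + m) x)) {0..2 * pi}"
    by (simp add: weight_def algebra_simps)
  then show ?case using Suc by (simp add: integral_unique)
qed simp

text \<open>By stability the approximating integrals are constant from index \<open>n\<close> on, so
  their weak limit is that constant.\<close>

lemma monic_norm2_riesz_product:
  assumes "riesz_product \<alpha> l \<rho>"
  shows "monic_norm2 \<rho> (\<Sum>j\<le>n. l j) q = integral {0..2 * pi}
    (\<lambda>x. (cmod (cis x ^ (\<Sum>j\<le>n. l j) + (\<Sum>k<(\<Sum>j\<le>n. l j). q k * cis x ^ k)))\<^sup>2 * weight n x) / (2 * pi)"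
proof -
  let ?f = "\<lambda>t::complex. (cmod (t ^ (\<Sum>j\<le>n. l j) + (\<Sum>k<(\<Sum>j\<le>n. l j). q k * t ^ k)))\<^sup>2"
  have cont: "continuous_on (sphere 0 1) ?f"
    by (intro continuous_intros)
  then have "(\<lambda>m. \<integral>t. ?f t \<partial>(riesz_partial \<alpha> l m)) \<longlonglongrightarrow> monic_norm2 \<rho> (\<Sum>j\<le>n. l j) q"
    using assms unfolding riesz_product_def circle_weak_conv_def monic_norm2_def by blast
  then have "(\<lambda>m. \<integral>t. ?f t \<partial>(riesz_partial \<alpha> l (m + n))) \<longlonglongrightarrow> monic_norm2 \<rho> (\<Sum>j\<le>n. l j) q"
    by (rule LIMSEQ_ignore_initial_segment)
  moreover have "(\<integral>t. ?f t \<partial>(riesz_partial \<alpha> l (m + n)))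
      = integral {0..2 * pi} (\<lambda>x. ?f (cis x) * weight n x) / (2 * pi)" for m
    using integral_weight_stable[OF cmod_sq_trig[OF monic_trig_in_trig[OF monic_trig_polynomial]], of n q m]
    unfolding integral_riesz_partial[OF bound cont] weight_def[symmetric] by (simp add: add.commute)
  ultimately show ?thesis by (simp add: LIMSEQ_const_iff)
qed

section \<open>The lower and upper estimates\<close>

text \<open>Fejer-Riesz factorization of each factor, with the constant split off so that the
  polynomial under the modulus is monic.\<close>

lemma weight_factorization:
  "weight n x = (\<Prod>j\<le>n. 1 / 2 * (1 + sqrt (1 - (\<alpha> j)\<^sup>2)))
     * (cmod (\<Prod>j\<le>n. cis (real (l j) * x) + of_real (\<alpha> j / (1 + sqrt (1 - (\<alpha> j)\<^sup>2)))))\<^sup>2"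
proof -
  have "1 + \<alpha> j * cos (real (l j) * x) = 1 / 2 * (1 + sqrt (1 - (\<alpha> j)\<^sup>2))
     * (cmod (cis (real (l j) * x) + of_real (\<alpha> j / (1 + sqrt (1 - (\<alpha> j)\<^sup>2)))))\<^sup>2" for j
  proof -
    define s where "s = sqrt (1 - (\<alpha> j)\<^sup>2)"
    \<comment> \<open>Since |e^{iy} + b|^2 = 1 + b^2 + 2 b cos y, a multiple (1 + s)/2 matches 1 +
      \<alpha> cos y when b (1 + s) = \<alpha> and b^2 (1 + s) = 1 - s.\<close>
    define b where "b = \<alpha> j / (1 + s)"
    have "(\<alpha> j)\<^sup>2 \<le> 1" using bound[of j] by (simp add: abs_square_le_1 abs_le_iff)
    then have s: "0 \<le> s" "s\<^sup>2 = 1 - (\<alpha> j)\<^sup>2" by (auto simp: s_def)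
    have b: "b * (1 + s) = \<alpha> j" using s by (simp add: b_def)
    have "b\<^sup>2 * (1 + s) * (1 + s) = (b * (1 + s))\<^sup>2" by (simp add: power2_eq_square)
    also have "\<dots> = (1 - s) * (1 + s)" using s unfolding b by (simp add: power2_eq_square algebra_simps)
    finally have "b\<^sup>2 * (1 + s) * (1 + s) = (1 - s) * (1 + s)" .
    then have b2: "b\<^sup>2 * (1 + s) = 1 - s" using s by simp
    have "(cmod (cis y + of_real b))\<^sup>2 = 1 + b\<^sup>2 + 2 * b * cos y" for y
      using sin_cos_squared_add[of y] unfolding cmod_power2
      by (simp add: power2_eq_square algebra_simps)
    moreover have "1 / 2 * (1 + s) * (1 + b\<^sup>2 + 2 * b * cos y)
        = ((1 + s) + b\<^sup>2 * (1 + s)) / 2 + (b * (1 + s)) * cos y" for y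
      by (simp add: field_simps)
    ultimately show ?thesis unfolding b2 b s_def[symmetric] b_def[symmetric] by simp
  qed
  then show ?thesis
    by (simp only: weight_def prod.distrib prod_power_distrib flip: prod_norm)
qed

lemma integral_monic_weight_ge:
  assumes "monic_trig m f"
  shows "2 * pi * (\<Prod>j\<le>n. 1 / 2 * (1 + sqrt (1 - (\<alpha> j)\<^sup>2)))
       \<le> integral {0..2 * pi} (\<lambda>x. (cmod (f x))\<^sup>2 * weight n x)"
proof -
  define C where "C = (\<Prod>j\<le>n. 1 / 2 * (1 + sqrt (1 - (\<alpha> j)\<^sup>2)))"
  define Q where "Q x = (\<Prod>j\<le>n. cis (real (l j) * x)
    + complex_of_real (\<alpha> j / (1 + sqrt (1 - (\<alpha> j)\<^sup>2))))" for x
  have "0 \<le> C"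
    unfolding C_def using bound
    by (intro prod_nonneg ballI mult_nonneg_nonneg add_nonneg_nonneg real_sqrt_ge_zero)
       (auto simp: abs_square_le_1 abs_le_iff)
  have "monic_trig (\<Sum>j\<le>n. l j) Q"
    unfolding Q_def using pos by (intro monic_trig_prod monic_trig_cis_const)
  from monic_trig_norm2_ge_1[OF monic_trig_mult[OF assms this]]
  have "C * (2 * pi) \<le> C * integral {0..2 * pi} (\<lambda>x. (cmod (f x * Q x))\<^sup>2)"
    using \<open>0 \<le> C\<close> by (rule mult_left_mono)
  also have "\<dots> = integral {0..2 * pi} (\<lambda>x. (cmod (f x))\<^sup>2 * weight n x)"
    unfolding weight_factorization C_def[symmetric] Q_def[symmetric]
    by (simp add: norm_mult power_mult_distrib mult.left_commute flip: integral_mult_right)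
  finally show ?thesis by (simp add: C_def mult.commute)
qed

text \<open>With constant term b in place of -\<alpha>/2, a single factor has mean 1 + b^2 +
  \<alpha> b, which is least at b = -\<alpha>/2.\<close>

lemma integral_trial_weight:
  "integral {0..2 * pi} (\<lambda>x. (cmod (\<Prod>j\<le>n. cis (real (l j) * x) + of_real (- \<alpha> j / 2)))\<^sup>2 * weight n x)
   = 2 * pi * (\<Prod>j\<le>n. 1 - (\<alpha> j)\<^sup>2 / 4)"
proof -
  \<comment> \<open>The oscillating part of one factor: expand (1 + \<alpha>^2/4 - \<alpha> cos y)(1
    + \<alpha> cos y) and write cos^2 y through cos 2y. The terms \<alpha> cos y cancel.\<close>
  define h where "h j x = complex_of_real ((\<alpha> j) ^ 3 / 4 * cos (real_of_int (int (l j)) * x))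
    + complex_of_real (- (\<alpha> j)\<^sup>2 / 2 * cos (real_of_int (2 * int (l j)) * x))" for j x
  have h: "h j \<in> trig S" if "{int (l j), - int (l j), 2 * int (l j), - (2 * int (l j))} \<subseteq> S" for j S
    unfolding h_def using that by (intro trig_sum2 cos_trig) auto
  have factor: "complex_of_real ((cmod (cis (real (l j) * x) + of_real (- \<alpha> j / 2)))\<^sup>2
      * (1 + \<alpha> j * cos (real (l j) * x))) = of_real (1 - (\<alpha> j)\<^sup>2 / 4) + h j x" for j x
  proof -
    define y where "y = real (l j) * x"
    have norm2: "(cmod (cis y + of_real (- \<alpha> j / 2)))\<^sup>2 = 1 + (\<alpha> j)\<^sup>2 / 4 - \<alpha> j * cos y"
      using sin_cos_squared_add[of y] unfolding cmod_power2
      by (simp add: power2_eq_square algebra_simps)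
    have "(cmod (cis y + of_real (- \<alpha> j / 2)))\<^sup>2 * (1 + \<alpha> j * cos y)
      = 1 - (\<alpha> j)\<^sup>2 / 4 + ((\<alpha> j) ^ 3 / 4 * cos y + - (\<alpha> j)\<^sup>2 / 2 * cos (2 * y))"
      unfolding norm2 cos_double_cos by (simp add: power2_eq_square power3_eq_cube field_simps)
    moreover have "real_of_int (int (l j)) * x = y" "real_of_int (2 * int (l j)) * x = 2 * y"
      by (simp_all add: y_def)
    ultimately show ?thesis
      by (simp only: h_def flip: y_def of_real_add)
  qed
  have "((\<lambda>x. \<Prod>j\<le>n. complex_of_real (1 - (\<alpha> j)\<^sup>2 / 4) + h j x) has_integral
      of_real (2 * pi) * (\<Prod>j\<le>n. of_real (1 - (\<alpha> j)\<^sup>2 / 4))) {0..2 * pi}"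
  \<comment> \<open>Each factor has degree 2 \<open>l j\<close>, so the required gap is exactly
    \<open>lacunary_gap\<close>.\<close>
  proof (rule lacunary_product_has_integral[where d = "\<lambda>j. 2 * l j"])
    show "h j \<in> trig {k. 0 < \<bar>k\<bar> \<and> \<bar>k\<bar> \<le> int (2 * l j)}" for j
      using pos[of j] by (intro h) auto
    show "h (Suc m) \<in> trig {k. int (\<Sum>j\<le>m. 2 * l j) < \<bar>k\<bar>}" for m
      using lacunary_gap[of m] unfolding sum_distrib_left[symmetric] by (intro h) (auto simp del: of_nat_sum)
  qed
  moreover have "complex_of_real ((cmod (\<Prod>j\<le>n. cis (real (l j) * x) + of_real (- \<alpha> j / 2)))\<^sup>2 * weight n x)
      = (\<Prod>j\<le>n. of_real (1 - (\<alpha> j)\<^sup>2 / 4) + h j x)" for x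
    unfolding factor[symmetric] of_real_prod[symmetric]
    by (simp only: weight_def prod.distrib prod_power_distrib flip: prod_norm)
  ultimately have "((\<lambda>x. complex_of_real
      ((cmod (\<Prod>j\<le>n. cis (real (l j) * x) + of_real (- \<alpha> j / 2)))\<^sup>2 * weight n x)) has_integral
      of_real (2 * pi * (\<Prod>j\<le>n. 1 - (\<alpha> j)\<^sup>2 / 4))) {0..2 * pi}"
    by (simp only: of_real_mult of_real_prod)
  from has_integral_Re[OF this] show ?thesis
    by (simp only: Re_complex_of_real integral_unique)
qed

end

theorem theorem13:
  fixes \<alpha> :: "nat \<Rightarrow> real" and l :: "nat \<Rightarrow> nat" and \<rho> :: "complex measure" and n :: nat
  assumes "\<And>j. - 1 \<le> \<alpha> j \<and> \<alpha> j \<le> 1"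
    and "\<And>j. 0 < l j"
    and "\<And>j. l (Suc j) \<ge> 3 * l j"
    and "riesz_product \<alpha> l \<rho>"
  shows "(\<Prod>j\<le>n. 1 / 2 * (1 + sqrt (1 - (\<alpha> j)\<^sup>2))) \<le> (extremal_e (\<Sum>j\<le>n. l j) \<rho>)\<^sup>2
       \<and> (extremal_e (\<Sum>j\<le>n. l j) \<rho>)\<^sup>2 \<le> (\<Prod>j\<le>n. 1 - (\<alpha> j)\<^sup>2 / 4)"
proof -
  let ?N = "\<Sum>j\<le>n. l j"
  note norm2 = monic_norm2_riesz_product[OF assms, of n]
  obtain q where q: "(extremal_e ?N \<rho>)\<^sup>2 = monic_norm2 \<rho> ?N q"
    and q_min: "\<And>q'. monic_norm2 \<rho> ?N q \<le> monic_norm2 \<rho> ?N q'"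
    using extremal_e_attained assms(4) unfolding riesz_product_def by metis
  have "(\<Prod>j\<le>n. 1 / 2 * (1 + sqrt (1 - (\<alpha> j)\<^sup>2))) \<le> monic_norm2 \<rho> ?N q"
    using integral_monic_weight_ge[of \<alpha> l, OF assms(1-3) monic_trig_polynomial[of ?N q], of n]
    unfolding norm2 by (subst pos_le_divide_eq) (auto simp: mult.commute)
  moreover have "monic_trig ?N (\<lambda>x. \<Prod>j\<le>n. cis (real (l j) * x) + of_real (- \<alpha> j / 2))"
    using assms(2) by (intro monic_trig_prod monic_trig_cis_const)
  then obtain p where p: "p \<in> trig {0..<int ?N}"
    and f: "(\<lambda>x. \<Prod>j\<le>n. cis (real (l j) * x) + of_real (- \<alpha> j / 2)) = (\<lambda>x. cis (real ?N * x) + p x)"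
    unfolding monic_trig_def by blast
  \<comment> \<open>The trial product becomes a coefficient sequence, which the minimality of
    \<open>q\<close> can be compared with.\<close>
  obtain q' where "p = (\<lambda>x. \<Sum>k<?N. q' k * cis x ^ k)"
    using trig_polynomialE[OF p] .
  with f have "(\<lambda>x. \<Prod>j\<le>n. cis (real (l j) * x) + of_real (- \<alpha> j / 2))
      = (\<lambda>x. cis x ^ ?N + (\<Sum>k<?N. q' k * cis x ^ k))"
    by (simp only: Complex.DeMoivre)
  then have "monic_norm2 \<rho> ?N q' = (\<Prod>j\<le>n. 1 - (\<alpha> j)\<^sup>2 / 4)"
    using integral_trial_weight[of \<alpha> l, OF assms(1-3), of n] unfolding norm2 fun_eq_iff by simp
  ultimately show ?thesis using q q_min[of q'] by simp
qed

end
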